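(* Let $p,q$ be positive integers, let $a\in M_{p\times q}(\mathbb N)$ be a fixed matrix such that $\sum_{i,j}a_{ij}$ is even, and put $k=\frac12\sum_{i,j}a_{ij}$. For $n\ge\max(p,q)$ let $$I(a)=\int_{O_n}\prod_{i=1}^p\prod_{j=1}^q u_{ij}^{a_{ij}}\,du .$$ Then, as $n\to\infty$: if all $a_{ij}$ are even, $$I(a)=n^{-k}\left(\prod_{i=1}^p\prod_{j=1}^q a_{ij}!!+O(n^{-1})\right),$$ and if not all $a_{ij}$ are even, $I(a)=O(n^{-k-1})$.
   Context: $\mathbb N=\{0,1,2,\ldots\}$. $O_n$ is the group of real orthogonal $n\times n$ matrices $u=(u_{ij})$, and $du$ is its normalized (probability) Haar measure. Convention for double factorials (non-standard): $x!!=(x-1)(x-3)(x-5)\cdots$, with the product ending at $1$ or $2$; empty products are $1$, so $0!!=1!!=1$, $2!!=1$, $3!!=2$, $4!!=3\cdot1$. The constants implied by $O(\cdot)$ may depend on $a$ but not on $n$. *)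

theory Defs
  imports
    "HOL-Probability.Probability"
    "HOL-Library.Landau_Symbols"
    "Jordan_Normal_Form.Matrix"
begin

text \<open>Matrix indices start at 0.\<close>

definition orthogonal_group :: "nat \<Rightarrow> real mat set" where
  "orthogonal_group n =
     {u \<in> carrier_mat n n. u * transpose_mat u = 1\<^sub>m n \<and> transpose_mat u * u = 1\<^sub>m n}"

text \<open>The Borel \<open>\<sigma>\<close>-algebra of \<open>orthogonal_group n\<close>, regarded as a subspace of the space
  of families of \<open>n * n\<close> reals: the type \<^typ>\<open>real mat\<close> carries no topology, so the
  \<open>\<sigma>\<close>-algebra is pulled back along the entries (a finite product of copies of the Borel
  \<open>\<sigma>\<close>-algebra of the reals is the Borel \<open>\<sigma>\<close>-algebra of the product topology).\<close>

definition orthogonal_borel :: "nat \<Rightarrow> real mat measure" where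
  "orthogonal_borel n =
     vimage_algebra (orthogonal_group n)
       (\<lambda>u. \<lambda>ij \<in> {..<n} \<times> {..<n}. u $$ ij)
       (Pi\<^sub>M ({..<n} \<times> {..<n}) (\<lambda>_. borel))"

text \<open>Normalized Haar measure is characterised as the (unique) left-invariant Borel probability
  measure; on a compact group it is then right-invariant as well.\<close>

definition normalized_haar :: "nat \<Rightarrow> real mat measure \<Rightarrow> bool" where
  "normalized_haar n M \<longleftrightarrow>
     prob_space M \<and> sets M = sets (orthogonal_borel n) \<and>
     (\<forall>g \<in> orthogonal_group n. \<forall>A \<in> sets M. emeasure M ((\<lambda>u. g * u) ` A) = emeasure M A)"

definition orthogonal_integral :: "real mat measure \<Rightarrow> nat mat \<Rightarrow> real" where
  "orthogonal_integral M a =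
     (LINT u|M. (\<Prod>i<dim_row a. \<Prod>j<dim_col a. u $$ (i, j) ^ (a $$ (i, j))))"

text \<open>The shifted convention \<open>x!! = (x - 1)(x - 3)(x - 5)\<dots>\<close>, so for instance
  \<open>3!! = 2\<close> and \<open>4!! = 3 \<cdot> 1\<close>.\<close>

fun dfact :: "nat \<Rightarrow> nat" where
  "dfact 0 = 1"
| "dfact (Suc 0) = 1"
| "dfact (Suc (Suc x)) = Suc x * dfact x"

end

theory Submission
  imports Defs
begin

text \<open>Invariance under infinitesimal rotations of two rows, together with the orthonormality
  of the columns, expresses \<open>n\<close> times the moment of a word \<open>W = u\<^sub>r\<^sub>c G\<close> of length \<open>2 k\<close> as
  the multiplicity of \<open>u\<^sub>r\<^sub>c\<close> in \<open>G\<close> times the moment of \<open>G\<close> with one \<open>u\<^sub>r\<^sub>c\<close> removed, up to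
  \<open>2 k\<close> moments of words of the same length. Taking the supremum over all words of that length
  absorbs the error terms and bounds all moments by \<open>O(n\<^sup>-\<^sup>k)\<close>. The error terms are
  therefore of lower order, and the leading coefficients satisfy the recursion
  \<open>g (m + 2) = (m + 1) g m\<close> of the Gaussian moments, with \<open>g 0 = 1\<close> and \<open>g 1 = 0\<close>.\<close>

section \<open>Words in the matrix entries and their moments\<close>

text \<open>A word is a multiset of index pairs: the factors commute, multiplicities record
  exponents, and deleting one factor is \<open>W - {#x#}\<close>.\<close>

definition monomial_at :: "real mat \<Rightarrow> (nat \<times> nat) multiset \<Rightarrow> real" where
  "monomial_at u W = (\<Prod>x\<in>#W. u $$ x)"

definition moment :: "real mat measure \<Rightarrow> (nat \<times> nat) multiset \<Rightarrow> real" where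
  "moment M W = (LINT u|M. monomial_at u W)"

lemma monomial_at_empty [simp]: "monomial_at u {#} = 1"
  by (simp add: monomial_at_def)

lemma monomial_at_add [simp]: "monomial_at u (add_mset x W) = u $$ x * monomial_at u W"
  by (simp add: monomial_at_def)

section \<open>The orthogonal group and bounds on its entries\<close>

lemma index_mult_mat_sum:
  assumes "A \<in> carrier_mat n m" "B \<in> carrier_mat m l" "i < n" "j < l"
  shows "(A * B) $$ (i, j) = (\<Sum>k<m. A $$ (i, k) * B $$ (k, j))"
  using assms by (auto simp: scalar_prod_def lessThan_atLeast0 intro!: sum.cong)

lemma orthogonal_groupD:
  assumes "u \<in> orthogonal_group n"
  shows "u \<in> carrier_mat n n" "u * transpose_mat u = 1\<^sub>m n" "transpose_mat u * u = 1\<^sub>m n"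
  using assms by (auto simp: orthogonal_group_def)

lemma orthogonal_group_columns:
  assumes u: "u \<in> orthogonal_group n" and "i < n" "j < n"
  shows "(\<Sum>k<n. u $$ (k, i) * u $$ (k, j)) = (if i = j then 1 else 0)"
proof -
  note U = orthogonal_groupD[OF u]
  have "(transpose_mat u * u) $$ (i, j) = (\<Sum>k<n. transpose_mat u $$ (i, k) * u $$ (k, j))"
    using U assms by (intro index_mult_mat_sum) auto
  also have "\<dots> = (\<Sum>k<n. u $$ (k, i) * u $$ (k, j))"
    using U assms by (intro sum.cong) auto
  finally show ?thesis using U(3) assms by simp
qed

text \<open>Columns are unit vectors. This bound is the source of all integrability and of the
  uniform error estimates.\<close>

lemma orthogonal_group_abs_entry_le:
  assumes u: "u \<in> orthogonal_group n" and "i < n" "j < n"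
  shows "\<bar>u $$ (i, j)\<bar> \<le> 1"
proof -
  have "u $$ (i, j) * u $$ (i, j) \<le> (\<Sum>k<n. u $$ (k, j) * u $$ (k, j))"
    using assms by (intro member_le_sum) auto
  also have "\<dots> = 1" using orthogonal_group_columns[OF u assms(3) assms(3)] by simp
  finally show ?thesis by (simp add: abs_square_le_1[symmetric] power2_eq_square)
qed

lemma orthogonal_group_mult:
  assumes "u \<in> orthogonal_group n" "v \<in> orthogonal_group n"
  shows "u * v \<in> orthogonal_group n"
proof -
  note U = orthogonal_groupD[OF assms(1)] and V = orthogonal_groupD[OF assms(2)]
  have T: "transpose_mat (u * v) = transpose_mat v * transpose_mat u"
    using U V by (intro transpose_mult) auto
  have ut: "transpose_mat u \<in> carrier_mat n n" and vt: "transpose_mat v \<in> carrier_mat n n"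
    using U V by auto
  have uv: "u * v \<in> carrier_mat n n" and vu: "transpose_mat v * transpose_mat u \<in> carrier_mat n n"
    using U(1) V(1) by auto
  have "u * v * (transpose_mat v * transpose_mat u) = u * (v * (transpose_mat v * transpose_mat u))"
    by (rule assoc_mult_mat[OF U(1) V(1) vu])
  also have "v * (transpose_mat v * transpose_mat u) = v * transpose_mat v * transpose_mat u"
    by (rule assoc_mult_mat[OF V(1) vt ut, symmetric])
  also have "u * \<dots> = 1\<^sub>m n"
    using U V ut by simp
  finally have 1: "u * v * (transpose_mat v * transpose_mat u) = 1\<^sub>m n" .
  have "transpose_mat v * transpose_mat u * (u * v) = transpose_mat v * (transpose_mat u * (u * v))"
    by (rule assoc_mult_mat[OF vt ut uv])
  also have "transpose_mat u * (u * v) = transpose_mat u * u * v"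
    by (rule assoc_mult_mat[OF ut U(1) V(1), symmetric])
  also have "transpose_mat v * \<dots> = 1\<^sub>m n"
    using U V by simp
  finally have 2: "transpose_mat v * transpose_mat u * (u * v) = 1\<^sub>m n" .
  show ?thesis
    unfolding orthogonal_group_def T using 1 2 uv T by simp
qed

lemma orthogonal_group_transpose:
  "u \<in> orthogonal_group n \<Longrightarrow> transpose_mat u \<in> orthogonal_group n"
  by (auto simp: orthogonal_group_def)

lemma abs_monomial_at_le:
  assumes u: "u \<in> orthogonal_group n" and "set_mset W \<subseteq> {..<n} \<times> {..<n}"
  shows "\<bar>monomial_at u W\<bar> \<le> 1"
  using assms(2)
proof (induction W)
  case (add x W)
  have "\<bar>u $$ x\<bar> \<le> 1" using orthogonal_group_abs_entry_le[OF u] add.prems by (cases x) auto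
  then show ?case using add by (auto simp: abs_mult intro: mult_le_one)
qed simp

section \<open>Plane rotations of two rows\<close>

text \<open>A Givens rotation when \<open>c\<^sup>2 + d\<^sup>2 = 1\<close>. With \<open>c\<close>
  and \<open>d\<close> as free parameters, transposing is just a change of sign of
  \<open>d\<close>.\<close>

definition rotation :: "nat \<Rightarrow> nat \<Rightarrow> nat \<Rightarrow> real \<Rightarrow> real \<Rightarrow> real mat" where
  "rotation n r s c d = mat n n (\<lambda>(i, j).
     if i = r then (if j = r then c else if j = s then d else 0)
     else if i = s then (if j = s then c else if j = r then - d else 0)
     else if i = j then 1 else 0)"

lemma rotation_carrier [simp]: "rotation n r s c d \<in> carrier_mat n n"
  by (simp add: rotation_def)

lemma rotation_mult_index:
  assumes "r < n" "s < n" "r \<noteq> s" "A \<in> carrier_mat n m" "i < n" "j < m"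
  shows "(rotation n r s c d * A) $$ (i, j) =
     (if i = r then c * A $$ (r, j) + d * A $$ (s, j)
      else if i = s then c * A $$ (s, j) - d * A $$ (r, j) else A $$ (i, j))"
proof -
  have "(rotation n r s c d * A) $$ (i, j) = (\<Sum>k<n. rotation n r s c d $$ (i, k) * A $$ (k, j))"
    using assms by (intro index_mult_mat_sum) auto
  \<comment> \<open>Row \<open>i\<close> of the rotation is split into point masses at
    \<open>r\<close>, \<open>s\<close> and \<open>i\<close>; the third is switched off for
    \<open>i = r\<close> and \<open>i = s\<close>, so that nothing is counted twice.\<close>
  also have "\<dots> = (\<Sum>k<n. (if k = r then (if i = r then c else if i = s then - d else 0) * A $$ (r, j) else 0)
     + (if k = s then (if i = s then c else if i = r then d else 0) * A $$ (s, j) else 0)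
     + (if k = i then (if i = r \<or> i = s then 0 else 1) * A $$ (i, j) else 0))"
    using assms by (intro sum.cong) (auto simp: rotation_def)
  also have "\<dots> = (if i = r then c * A $$ (r, j) + d * A $$ (s, j)
      else if i = s then c * A $$ (s, j) - d * A $$ (r, j) else A $$ (i, j))"
    using assms by (simp add: sum.distrib)
  finally show ?thesis .
qed

lemma transpose_rotation:
  assumes "r < n" "s < n" "r \<noteq> s"
  shows "transpose_mat (rotation n r s c d) = rotation n r s c (- d)"
  using assms by (intro eq_matI) (auto simp: rotation_def)

lemma rotation_mult_rotation:
  assumes "r < n" "s < n" "r \<noteq> s" "c\<^sup>2 + d\<^sup>2 = 1"
  shows "rotation n r s c d * rotation n r s c (- d) = 1\<^sub>m n"
proof (intro eq_matI)
  fix i j assume "i < dim_row (1\<^sub>m n :: real mat)" "j < dim_col (1\<^sub>m n :: real mat)"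
  then have ij: "i < n" "j < n" by auto
  show "(rotation n r s c d * rotation n r s c (- d)) $$ (i, j) = 1\<^sub>m n $$ (i, j)"
    using assms ij
    by (subst rotation_mult_index[OF assms(1-3) rotation_carrier ij])
       (auto simp: rotation_def power2_eq_square)
qed (auto simp: rotation_def)

lemma rotation_orthogonal:
  assumes "r < n" "s < n" "r \<noteq> s" "c\<^sup>2 + d\<^sup>2 = 1"
  shows "rotation n r s c d \<in> orthogonal_group n"
  using rotation_mult_rotation[OF assms] rotation_mult_rotation[of r n s c "- d"] assms
  by (simp add: orthogonal_group_def transpose_rotation)

section \<open>First-order effect of a rotation on monomials\<close>

text \<open>The derivative at angle zero of entry \<open>x\<close> of the rotated matrix.\<close>

definition rotation_derivative :: "nat \<Rightarrow> nat \<Rightarrow> real mat \<Rightarrow> nat \<times> nat \<Rightarrow> real" where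
  "rotation_derivative r s u x =
     (if fst x = r then u $$ (s, snd x) else if fst x = s then - u $$ (r, snd x) else 0)"

text \<open>The product rule. The sum runs over occurrences, so a power contributes its exponent as
  a factor.\<close>

definition monomial_derivative ::
    "nat \<Rightarrow> nat \<Rightarrow> real mat \<Rightarrow> (nat \<times> nat) multiset \<Rightarrow> real" where
  "monomial_derivative r s u W =
     (\<Sum>x\<in>#W. rotation_derivative r s u x * monomial_at u (W - {#x#}))"

text \<open>Multiset subtraction is truncated, so the two arguments of \<open>f\<close> differ when
  \<open>y = x\<close> does not occur in \<open>W\<close>; such a \<open>y\<close> is never summed
  over.\<close>

lemma sum_mset_add_remove:
  fixes f :: "'a \<Rightarrow> 'a multiset \<Rightarrow> 'b::comm_monoid_add"
  shows "(\<Sum>y\<in>#W. f y (add_mset x W - {#y#})) = (\<Sum>y\<in>#W. f y (add_mset x (W - {#y#})))"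
proof (intro arg_cong[of _ _ sum_mset] image_mset_cong)
  fix y assume "y \<in># W"
  then have "add_mset x W - {#y#} = add_mset x (W - {#y#})"
    by (cases "x = y") (auto)
  then show "f y (add_mset x W - {#y#}) = f y (add_mset x (W - {#y#}))" by simp
qed

lemma monomial_derivative_empty [simp]: "monomial_derivative r s u {#} = 0"
  by (simp add: monomial_derivative_def)

text \<open>The Leibniz rule for one extra factor, which drives the later inductions over
  words.\<close>

lemma monomial_derivative_add [simp]:
  "monomial_derivative r s u (add_mset x W) =
     rotation_derivative r s u x * monomial_at u W + u $$ x * monomial_derivative r s u W"
proof -
  let ?f = "\<lambda>y V. rotation_derivative r s u y * monomial_at u V"
  have f: "?f y (add_mset x V) = u $$ x * ?f y V" for y V by simp
  show ?thesis
    unfolding monomial_derivative_def image_mset_add_mset sum_mset.add_mset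
      sum_mset_add_remove[of ?f] f sum_mset_distrib_left[symmetric]
    by simp
qed

lemma abs_rotation_derivative_le:
  assumes "u \<in> orthogonal_group n" "r < n" "s < n" "x \<in> {..<n} \<times> {..<n}"
  shows "\<bar>rotation_derivative r s u x\<bar> \<le> 1"
  using assms orthogonal_group_abs_entry_le[OF assms(1)] by (auto simp: rotation_derivative_def)

lemma abs_monomial_derivative_le:
  assumes u: "u \<in> orthogonal_group n" "r < n" "s < n" and "set_mset W \<subseteq> {..<n} \<times> {..<n}"
  shows "\<bar>monomial_derivative r s u W\<bar> \<le> size W"
  using assms(4)
proof (induction W)
  case (add x W)
  have x: "\<bar>u $$ x\<bar> \<le> 1"
    using orthogonal_group_abs_entry_le[OF u(1)] add.prems by (cases x) auto
  have "\<bar>rotation_derivative r s u x * monomial_at u W\<bar> \<le> 1"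
    using abs_rotation_derivative_le[OF u] abs_monomial_at_le[OF u(1)] add.prems
    by (auto simp: abs_mult intro!: mult_le_one)
  moreover have "\<bar>u $$ x * monomial_derivative r s u W\<bar> \<le> 1 * real (size W)"
    unfolding abs_mult using x add by (intro mult_mono) auto
  ultimately show ?case by simp
qed simp

text \<open>The rational parametrisation of the circle keeps all error estimates algebraic.\<close>

definition rational_rotation :: "nat \<Rightarrow> nat \<Rightarrow> nat \<Rightarrow> real \<Rightarrow> real mat" where
  "rational_rotation n r s t = rotation n r s ((1 - t\<^sup>2) / (1 + t\<^sup>2)) (2 * t / (1 + t\<^sup>2))"

lemma rational_rotation_orthogonal:
  assumes "r < n" "s < n" "r \<noteq> s"
  shows "rational_rotation n r s t \<in> orthogonal_group n"
proof -
  have "1 + t\<^sup>2 > 0" by (simp add: add_pos_nonneg)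
  moreover have "(1 - t\<^sup>2)\<^sup>2 + (2 * t)\<^sup>2 = (1 + t\<^sup>2)\<^sup>2"
    by (simp add: power2_eq_square algebra_simps)
  ultimately have "((1 - t\<^sup>2) / (1 + t\<^sup>2))\<^sup>2 + (2 * t / (1 + t\<^sup>2))\<^sup>2 = 1"
    by (simp add: power_divide add_divide_distrib[symmetric])
  then show ?thesis
    unfolding rational_rotation_def by (intro rotation_orthogonal assms)
qed

text \<open>The parameter \<open>t\<close> is the tangent of half the angle, whence the factor
  \<open>2 * t\<close>. Cosine and sine deviate from \<open>1\<close> and \<open>2 * t\<close> by at
  most \<open>2 * t\<^sup>2\<close> each, and the entries they multiply are at most 1 in absolute
  value.\<close>

lemma rational_rotation_entry_expansion:
  assumes u: "u \<in> orthogonal_group n" and rs: "r < n" "s < n" "r \<noteq> s"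
    and x: "x \<in> {..<n} \<times> {..<n}" and t: "0 \<le> t" "t \<le> 1"
  shows "\<bar>(rational_rotation n r s t * u) $$ x - u $$ x - 2 * t * rotation_derivative r s u x\<bar>
    \<le> 4 * t\<^sup>2"
proof -
  obtain i j where ij: "x = (i, j)" "i < n" "j < n" using x by auto
  define c where "c = (1 - t\<^sup>2) / (1 + t\<^sup>2)"
  define d where "d = 2 * t / (1 + t\<^sup>2)"
  have pos: "1 + t\<^sup>2 > 0" by (simp add: add_pos_nonneg)
  have c1: "c - 1 = - 2 * t\<^sup>2 / (1 + t\<^sup>2)"
    using pos unfolding c_def by (simp add: field_simps)
  have d1: "d - 2 * t = - 2 * t\<^sup>2 * t / (1 + t\<^sup>2)"
    using pos unfolding d_def by (simp add: field_simps power2_eq_square)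
  have c: "\<bar>c - 1\<bar> \<le> 2 * t\<^sup>2"
    using pos unfolding c1 by (simp add: abs_div divide_le_eq mult_left_mono algebra_simps)
  \<comment> \<open>Uses \<open>t \<le> 1\<close>, hence
    \<open>t \<le> 1 + t\<^sup>2\<close>.\<close>
  have "2 * t\<^sup>2 * t \<le> 2 * t\<^sup>2 * (1 + t\<^sup>2)"
    using t by (intro mult_left_mono) (auto intro: order_trans[of t 1])
  then have d: "\<bar>d - 2 * t\<bar> \<le> 2 * t\<^sup>2"
    using pos t unfolding d1 by (simp add: abs_mult abs_div divide_le_eq)
  have *: "\<bar>(c - 1) * y + (d - 2 * t) * z\<bar> \<le> 4 * t\<^sup>2" if "\<bar>y\<bar> \<le> 1" "\<bar>z\<bar> \<le> 1" for y z
  proof -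
    have "\<bar>(c - 1) * y\<bar> \<le> 2 * t\<^sup>2 * 1" "\<bar>(d - 2 * t) * z\<bar> \<le> 2 * t\<^sup>2 * 1"
      unfolding abs_mult using c d that by (intro mult_mono; simp)+
    then show ?thesis by linarith
  qed
  have r: "\<bar>u $$ (r, j)\<bar> \<le> 1" and s: "\<bar>u $$ (s, j)\<bar> \<le> 1"
    using orthogonal_group_abs_entry_le[OF u] rs ij by auto
  show ?thesis
    unfolding rational_rotation_def ij(1) c_def[symmetric] d_def[symmetric]
    \<comment> \<open>The first instance serves row \<open>r\<close>; the second, with the sign of
      the derivative built in, serves row \<open>s\<close>. All other rows are fixed.\<close>
    using *[OF r s] *[OF s, of "- u $$ (r, j)"] r rs
    by (subst rotation_mult_index[OF rs orthogonal_groupD(1)[OF u] ij(2,3)])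
       (auto simp: rotation_derivative_def algebra_simps)
qed

text \<open>Induction over the word by the Leibniz rule. The constant depends neither on
  \<open>u\<close> nor on \<open>t\<close>, so the estimate can be integrated over \<open>u\<close>
  before \<open>t\<close> tends to 0.\<close>

lemma rational_rotation_monomial_expansion:
  assumes rs: "r < n" "s < n" "r \<noteq> s" and "set_mset W \<subseteq> {..<n} \<times> {..<n}"
  shows "\<exists>C\<ge>0. \<forall>u\<in>orthogonal_group n. \<forall>t\<in>{0..1}.
    \<bar>monomial_at (rational_rotation n r s t * u) W - monomial_at u W
      - 2 * t * monomial_derivative r s u W\<bar> \<le> C * t\<^sup>2"
  using assms(4)
proof (induction W)
  case empty
  then show ?case by (auto intro!: exI[of _ 0])
next
  case (add x W)
  then obtain C where C: "C \<ge> 0" "\<And>u t. u \<in> orthogonal_group n \<Longrightarrow> t \<in> {0..1} \<Longrightarrow>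
    \<bar>monomial_at (rational_rotation n r s t * u) W - monomial_at u W
      - 2 * t * monomial_derivative r s u W\<bar> \<le> C * t\<^sup>2" by auto
  show ?case
  \<comment> \<open>Multiplying the expansions of the new factor and of \<open>W\<close> leaves
    three remainders: \<open>e\<close> times a bounded monomial (4), a bounded entry times
    \<open>f\<close> (\<open>C\<close>), and the cross term
    (\<open>2 * (2 * size W + C)\<close>).\<close>
  proof (intro exI[of _ "4 + 3 * C + 4 * real (size W)"] conjI ballI)
    fix u and t :: real assume u: "u \<in> orthogonal_group n" and t: "t \<in> {0..1}"
    define v where "v = rational_rotation n r s t * u"
    define x' where "x' = rotation_derivative r s u x"
    define p' where "p' = monomial_derivative r s u W"
    define e where "e = v $$ x - u $$ x - 2 * t * x'"
    define f where "f = monomial_at v W - monomial_at u W - 2 * t * p'"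
    have W: "set_mset W \<subseteq> {..<n} \<times> {..<n}" and x: "x \<in> {..<n} \<times> {..<n}" using add.prems by auto
    have v: "v \<in> orthogonal_group n"
      unfolding v_def by (intro orthogonal_group_mult rational_rotation_orthogonal rs u)
    have bounds: "\<bar>e\<bar> \<le> 4 * t\<^sup>2" "\<bar>f\<bar> \<le> C * t\<^sup>2" "\<bar>x'\<bar> \<le> 1" "\<bar>p'\<bar> \<le> size W"
      "\<bar>monomial_at v W\<bar> \<le> 1" "\<bar>u $$ x\<bar> \<le> 1"
      unfolding e_def f_def v_def x'_def p'_def
      using rational_rotation_entry_expansion[OF u rs x, of t] C(2)[OF u t] t
        abs_rotation_derivative_le[OF u rs(1,2) x] abs_monomial_derivative_le[OF u rs(1,2) W]
        abs_monomial_at_le[OF v W, unfolded v_def] orthogonal_group_abs_entry_le[OF u, of "fst x" "snd x"] x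
      by (auto simp: mem_Times_iff)
    \<comment> \<open>On the unit interval \<open>f\<close> is thus also of order \<open>t\<close>,
      which makes the cross term quadratic.\<close>
    have tt: "t\<^sup>2 \<le> t" using t by (simp add: power2_eq_square mult_left_le)
    have "C * t\<^sup>2 \<le> C * t" using tt C(1) by (intro mult_left_mono)
    moreover have "\<bar>2 * t * p'\<bar> \<le> 2 * t * size W"
      unfolding abs_mult using bounds(4) t by (intro mult_mono) auto
    ultimately have "\<bar>f + 2 * t * p'\<bar> \<le> (2 * size W + C) * t"
      using bounds(2) by (auto simp: algebra_simps)
    then have "\<bar>2 * t * x'\<bar> * \<bar>f + 2 * t * p'\<bar> \<le> (2 * t) * ((2 * size W + C) * t)"
      using t bounds(3) by (intro mult_mono) (auto simp: abs_mult mult_left_le)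
    moreover have "\<bar>e\<bar> * \<bar>monomial_at v W\<bar> \<le> 4 * t\<^sup>2 * 1" "\<bar>u $$ x\<bar> * \<bar>f\<bar> \<le> 1 * (C * t\<^sup>2)"
      using bounds C(1) by (intro mult_mono; simp)+
    ultimately have "\<bar>e * monomial_at v W + u $$ x * f + 2 * t * x' * (f + 2 * t * p')\<bar>
        \<le> (4 + 3 * C + 4 * real (size W)) * t\<^sup>2"
      unfolding abs_mult[symmetric] by (auto simp: algebra_simps power2_eq_square)
    moreover have "monomial_at v (add_mset x W) - monomial_at u (add_mset x W)
        - 2 * t * monomial_derivative r s u (add_mset x W) =
        e * monomial_at v W + u $$ x * f + 2 * t * x' * (f + 2 * t * p')"
      by (simp add: e_def f_def x'_def p'_def algebra_simps)
    ultimately show "\<bar>monomial_at (rational_rotation n r s t * u) (add_mset x W)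
        - monomial_at u (add_mset x W) - 2 * t * monomial_derivative r s u (add_mset x W)\<bar>
      \<le> (4 + 3 * C + 4 * real (size W)) * t\<^sup>2"
      unfolding v_def by simp
  qed (use C(1) in auto)
qed

section \<open>Haar measure: measurability, integrability and invariance\<close>

locale haar_orthogonal =
  fixes n :: nat and M :: "real mat measure"
  assumes haar: "normalized_haar n M"
begin

sublocale prob_space M
  using haar by (simp add: normalized_haar_def)

lemma sets_haar: "sets M = sets (orthogonal_borel n)"
  using haar by (simp add: normalized_haar_def)

lemma space_haar: "space M = orthogonal_group n"
  using sets_eq_imp_space_eq[OF sets_haar] unfolding orthogonal_borel_def space_vimage_algebra .

lemma measurable_entry:
  assumes "x \<in> {..<n} \<times> {..<n}"
  shows "(\<lambda>u. u $$ x) \<in> borel_measurable M"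
proof -
  let ?I = "{..<n} \<times> {..<n}"
  let ?f = "\<lambda>u :: real mat. \<lambda>ij\<in>?I. u $$ ij"
  have "?f \<in> measurable (orthogonal_borel n) (Pi\<^sub>M ?I (\<lambda>_. borel))"
    unfolding orthogonal_borel_def by (rule measurable_vimage_algebra1) (simp add: space_PiM)
  from measurable_compose[OF this measurable_component_singleton[OF assms]]
  have "(\<lambda>u. ?f u x) \<in> borel_measurable M"
    unfolding measurable_cong_sets[OF sets_haar refl] .
  then show ?thesis
    using assms by simp
qed

text \<open>Since the sigma-algebra is generated by the entries, it suffices that each entry of
  \<open>g * u\<close> is a linear combination of entries of \<open>u\<close>.\<close>

lemma measurable_left_mult:
  assumes g: "g \<in> orthogonal_group n"
  shows "(\<lambda>u. g * u) \<in> measurable M M"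
proof -
  have "(\<lambda>u. \<lambda>ij\<in>{..<n} \<times> {..<n}. (g * u) $$ ij) \<in> measurable M (Pi\<^sub>M ({..<n} \<times> {..<n}) (\<lambda>_. borel))"
  proof (rule measurable_restrict)
    fix ij assume "ij \<in> {..<n} \<times> {..<n}"
    then obtain i j where ij: "ij = (i, j)" "i < n" "j < n" by auto
    have "(\<lambda>u. \<Sum>k<n. g $$ (i, k) * u $$ (k, j)) \<in> borel_measurable M"
      using ij by (intro borel_measurable_sum borel_measurable_times measurable_entry) auto
    also have "?this \<longleftrightarrow> (\<lambda>u. (g * u) $$ ij) \<in> borel_measurable M"
      unfolding ij(1)
      by (intro measurable_cong)
        (simp add: space_haar index_mult_mat_sum[OF orthogonal_groupD(1)[OF g] orthogonal_groupD(1) ij(2,3)])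
    finally show "(\<lambda>u. (g * u) $$ ij) \<in> borel_measurable M" .
  qed
  then have "(\<lambda>u. g * u) \<in> measurable M (orthogonal_borel n)"
    unfolding orthogonal_borel_def using g
    by (intro measurable_vimage_algebra2) (auto simp: space_haar orthogonal_group_mult)
  then show ?thesis by (simp add: measurable_cong_sets[OF refl sets_haar])
qed

text \<open>\<open>normalized_haar\<close> speaks of images, a pushforward of preimages. The
  preimage under \<open>g\<close> is the image under its transpose, which is the inverse of
  \<open>g\<close> and again orthogonal.\<close>

lemma distr_left_mult:
  assumes g: "g \<in> orthogonal_group n"
  shows "distr M M (\<lambda>u. g * u) = M"
proof (rule measure_eqI)
  fix A assume "A \<in> sets (distr M M (\<lambda>u. g * u))"
  then have A: "A \<in> sets M" by simp
  then have sub: "A \<subseteq> orthogonal_group n" using sets.sets_into_space space_haar by blast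
  let ?h = "transpose_mat g"
  note G = orthogonal_groupD[OF g]
  have inv: "?h * (g * u) = u" "g * (?h * u) = u" if "u \<in> orthogonal_group n" for u
  proof -
    note U = orthogonal_groupD(1)[OF that]
    have h: "?h \<in> carrier_mat n n" using G(1) by simp
    show "?h * (g * u) = u" using assoc_mult_mat[OF h G(1) U] G(3) U by simp
    show "g * (?h * u) = u" using assoc_mult_mat[OF G(1) h U] G(2) U by simp
  qed
  have "(\<lambda>u. g * u) -` A \<inter> space M = (\<lambda>u. ?h * u) ` A"
  proof (intro equalityI subsetI)
    fix u assume u: "u \<in> (\<lambda>u. g * u) -` A \<inter> space M"
    then have "u = ?h * (g * u)" using inv by (simp add: space_haar)
    then show "u \<in> (\<lambda>u. ?h * u) ` A" using u by blast
  next
    fix u assume "u \<in> (\<lambda>u. ?h * u) ` A"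
    then obtain v where v: "v \<in> A" "u = ?h * v" by auto
    then show "u \<in> (\<lambda>u. g * u) -` A \<inter> space M"
      using sub inv(2)[of v] orthogonal_group_mult[OF orthogonal_group_transpose[OF g], of v]
      by (auto simp: space_haar)
  qed
  then show "emeasure (distr M M (\<lambda>u. g * u)) A = emeasure M A"
    using haar A orthogonal_group_transpose[OF g]
    by (simp add: emeasure_distr[OF measurable_left_mult[OF g]] normalized_haar_def)
qed simp

lemma integrable_monomial_at:
  assumes "set_mset W \<subseteq> {..<n} \<times> {..<n}"
  shows "integrable M (\<lambda>u. monomial_at u W)"
proof (rule integrable_const_bound[where B = 1])
  show "AE u in M. norm (monomial_at u W) \<le> 1"
    using abs_monomial_at_le assms by (auto simp: space_haar)
  show "(\<lambda>u. monomial_at u W) \<in> borel_measurable M"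
    using assms by (induction W) (auto intro!: borel_measurable_times measurable_entry)
qed

lemma integrable_monomial_derivative:
  assumes "r < n" "s < n" "set_mset W \<subseteq> {..<n} \<times> {..<n}"
  shows "integrable M (\<lambda>u. monomial_derivative r s u W)"
proof (rule integrable_const_bound[where B = "size W"])
  show "AE u in M. norm (monomial_derivative r s u W) \<le> size W"
    using abs_monomial_derivative_le assms by (auto simp: space_haar)
  show "(\<lambda>u. monomial_derivative r s u W) \<in> borel_measurable M"
    using assms(3)
  proof (induction W)
    case (add x W)
    then have x: "x \<in> {..<n} \<times> {..<n}" and W: "set_mset W \<subseteq> {..<n} \<times> {..<n}" by auto
    have "(\<lambda>u. rotation_derivative r s u x) \<in> borel_measurable M"
      using x assms measurable_entry[of "(r, snd x)"] measurable_entry[of "(s, snd x)"]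
      by (cases "fst x = r"; cases "fst x = s") (auto simp: rotation_derivative_def mem_Times_iff)
    then show ?case
      using add.IH[OF W] measurable_entry[OF x] integrable_monomial_at[OF W]
      by (auto intro!: borel_measurable_add borel_measurable_times)
  qed simp
qed

lemma integral_monomial_left_mult:
  assumes g: "g \<in> orthogonal_group n" and W: "set_mset W \<subseteq> {..<n} \<times> {..<n}"
  shows "integrable M (\<lambda>u. monomial_at (g * u) W)"
    and "(LINT u|M. monomial_at (g * u) W) = moment M W"
  using integral_distr[OF measurable_left_mult[OF g], of "\<lambda>u. monomial_at u W"]
    integrable_distr_eq[OF measurable_left_mult[OF g], of "\<lambda>u. monomial_at u W"]
    integrable_monomial_at[OF W]
  by (simp_all add: distr_left_mult[OF g] moment_def)

text \<open>By invariance the zeroth-order terms cancel after integration, leaving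
  \<open>2 * t * \<bar>D\<bar> \<le> C * t\<^sup>2\<close>. Dividing by \<open>t\<close> replaces
  differentiation under the integral sign.\<close>

lemma integral_monomial_derivative:
  assumes rs: "r < n" "s < n" "r \<noteq> s" and W: "set_mset W \<subseteq> {..<n} \<times> {..<n}"
  shows "(LINT u|M. monomial_derivative r s u W) = 0"
proof -
  define D where "D = (LINT u|M. monomial_derivative r s u W)"
  obtain C where C: "C \<ge> 0" "\<And>u t. u \<in> orthogonal_group n \<Longrightarrow> t \<in> {0..1} \<Longrightarrow>
    \<bar>monomial_at (rational_rotation n r s t * u) W - monomial_at u W
      - 2 * t * monomial_derivative r s u W\<bar> \<le> C * t\<^sup>2"
    using rational_rotation_monomial_expansion[OF rs W] by blast
  have le: "\<bar>D\<bar> \<le> C * t" if t: "t \<in> {0<..1}" for t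
  proof -
    define F where "F u = monomial_at (rational_rotation n r s t * u) W - monomial_at u W
      - 2 * t * monomial_derivative r s u W" for u
    note int = integral_monomial_left_mult[OF rational_rotation_orthogonal[OF rs] W, of t]
      integrable_monomial_at[OF W] integrable_monomial_derivative[OF rs(1,2) W]
    have F: "integrable M F" unfolding F_def using int by auto
    have le: "\<bar>F u\<bar> \<le> C * t\<^sup>2" if "u \<in> space M" for u
      using C(2) t that by (auto simp: F_def space_haar)
    have "(LINT u|M. F u) = - (2 * t * D)"
      unfolding F_def D_def using int by (simp add: moment_def)
    moreover have "\<bar>LINT u|M. F u\<bar> \<le> (LINT u|M. C * t\<^sup>2)"
      using F le by (intro order_trans[OF integral_abs_bound] integral_mono) auto
    ultimately have "2 * t * \<bar>D\<bar> \<le> C * t\<^sup>2"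
      using t by (simp add: abs_mult prob_space)
    then have "t * (2 * \<bar>D\<bar>) \<le> t * (C * t)" by (simp add: power2_eq_square algebra_simps)
    then have "2 * \<bar>D\<bar> \<le> C * t" using t by simp
    then show ?thesis by linarith
  qed
  \<comment> \<open>The limit is one-sided because the expansion is available for \<open>t\<close>
    in the unit interval only.\<close>
  have "((\<lambda>t. C * t) \<longlongrightarrow> C * 0) (at_right 0)"
    by (intro tendsto_intros)
  moreover have "\<forall>\<^sub>F t in at_right 0. \<bar>D\<bar> \<le> C * t"
    using le eventually_at_right_real[of 0 1] by (auto elim!: eventually_mono)
  ultimately have "\<bar>D\<bar> \<le> C * 0"
    by (intro tendsto_lowerbound) auto
  then show ?thesis by (simp add: D_def)
qed

end

section \<open>The loop equation for moments\<close>

text \<open>If \<open>y\<close> lies in row \<open>r\<close>, the sum is an inner product of two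
  columns without its term \<open>s = r\<close>, and orthonormality gives the Kronecker delta.
  Otherwise only \<open>s = fst y\<close> contributes.\<close>

lemma sum_rotation_derivative:
  assumes u: "u \<in> orthogonal_group n" and "r < n" "c < n" and y: "y \<in> {..<n} \<times> {..<n}"
  shows "(\<Sum>s\<in>{..<n} - {r}. u $$ (s, c) * rotation_derivative r s u y) =
    (if y = (r, c) then 1 else 0) - u $$ (r, snd y) * u $$ (fst y, c)"
proof -
  obtain i j where ij: "y = (i, j)" "i < n" "j < n" using y by auto
  show ?thesis
  proof (cases "i = r")
    case True
    have "(\<Sum>s\<in>{..<n} - {r}. u $$ (s, c) * u $$ (s, j)) =
        (\<Sum>s<n. u $$ (s, c) * u $$ (s, j)) - u $$ (r, c) * u $$ (r, j)"
      using assms(2) by (subst sum_diff1) auto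
    then show ?thesis
      using True ij orthogonal_group_columns[OF u assms(3) ij(3)]
      by (auto simp: rotation_derivative_def)
  next
    case False
    have "(\<Sum>s\<in>{..<n} - {r}. u $$ (s, c) * rotation_derivative r s u y) =
        (\<Sum>s\<in>{..<n} - {r}. if s = i then - u $$ (r, j) * u $$ (i, c) else 0)"
      using False ij by (intro sum.cong) (auto simp: rotation_derivative_def)
    also have "\<dots> = - u $$ (r, j) * u $$ (i, c)"
      using False ij by simp
    finally show ?thesis using False ij by simp
  qed
qed

lemma sum_sum_mset_swap:
  fixes f :: "'a \<Rightarrow> 'b \<Rightarrow> 'c::comm_monoid_add"
  shows "(\<Sum>s\<in>A. \<Sum>y\<in>#W. f s y) = (\<Sum>y\<in>#W. \<Sum>s\<in>A. f s y)"
  by (induction W) (auto simp: sum.distrib)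

text \<open>Differentiating the leading factor \<open>u $$ (s, c)\<close> gives
  \<open>- u $$ (r, c)\<close> for each of the \<open>n - 1\<close> values of \<open>s\<close>, that
  is, \<open>n - 1\<close> copies of one word. Differentiating inside \<open>G\<close> gives the
  sums evaluated in \<open>sum_rotation_derivative\<close>.\<close>

lemma sum_monomial_derivative:
  assumes u: "u \<in> orthogonal_group n" and rc: "r < n" "c < n" and G: "set_mset G \<subseteq> {..<n} \<times> {..<n}"
  shows "(\<Sum>s\<in>{..<n} - {r}. monomial_derivative r s u (add_mset (s, c) G)) =
    (\<Sum>y\<in>#G. (if y = (r, c) then monomial_at u (G - {#y#}) else 0)
        - monomial_at u (add_mset (r, snd y) (add_mset (fst y, c) (G - {#y#}))))
    - (real n - 1) * monomial_at u (add_mset (r, c) G)"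
proof -
  let ?P = "\<lambda>y. monomial_at u (G - {#y#})"
  have "(\<Sum>s\<in>{..<n} - {r}. monomial_derivative r s u (add_mset (s, c) G)) =
      (\<Sum>s\<in>{..<n} - {r}. (\<Sum>y\<in>#G. u $$ (s, c) * rotation_derivative r s u y * ?P y)
         - monomial_at u (add_mset (r, c) G))"
  proof (intro sum.cong refl)
    fix s assume s: "s \<in> {..<n} - {r}"
    have "(\<Sum>y\<in>#G. u $$ (s, c) * rotation_derivative r s u y * ?P y) =
        u $$ (s, c) * monomial_derivative r s u G"
      unfolding monomial_derivative_def mult.assoc by (rule sum_mset_distrib_left[symmetric])
    then show "monomial_derivative r s u (add_mset (s, c) G) =
        (\<Sum>y\<in>#G. u $$ (s, c) * rotation_derivative r s u y * ?P y) - monomial_at u (add_mset (r, c) G)"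
      using s by (simp add: rotation_derivative_def)
  qed
  also have "\<dots> = (\<Sum>s\<in>{..<n} - {r}. \<Sum>y\<in>#G. u $$ (s, c) * rotation_derivative r s u y * ?P y)
      - (real n - 1) * monomial_at u (add_mset (r, c) G)"
    using rc(1) by (simp add: sum_subtractf of_nat_diff)
  also have "(\<Sum>s\<in>{..<n} - {r}. \<Sum>y\<in>#G. u $$ (s, c) * rotation_derivative r s u y * ?P y)
      = (\<Sum>y\<in>#G. \<Sum>s\<in>{..<n} - {r}. u $$ (s, c) * rotation_derivative r s u y * ?P y)"
    by (rule sum_sum_mset_swap)
  also have "\<dots> = (\<Sum>y\<in>#G. (if y = (r, c) then ?P y else 0)
        - monomial_at u (add_mset (r, snd y) (add_mset (fst y, c) (G - {#y#}))))"
  proof (intro arg_cong[of _ _ sum_mset] image_mset_cong)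
    fix y assume "y \<in># G"
    then have y: "y \<in> {..<n} \<times> {..<n}" using G by blast
    have "(\<Sum>s\<in>{..<n} - {r}. u $$ (s, c) * rotation_derivative r s u y * ?P y) =
        ((if y = (r, c) then 1 else 0) - u $$ (r, snd y) * u $$ (fst y, c)) * ?P y"
      by (simp only: sum_distrib_right[symmetric] sum_rotation_derivative[OF u rc y])
    then show "(\<Sum>s\<in>{..<n} - {r}. u $$ (s, c) * rotation_derivative r s u y * ?P y) =
        (if y = (r, c) then ?P y else 0)
        - monomial_at u (add_mset (r, snd y) (add_mset (fst y, c) (G - {#y#})))"
      by (simp add: algebra_simps)
  qed
  finally show ?thesis .
qed

lemma integral_sum_mset:
  fixes f :: "'b \<Rightarrow> 'a \<Rightarrow> real"
  assumes "\<And>y. y \<in># W \<Longrightarrow> integrable M (f y)"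
  shows "integrable M (\<lambda>u. \<Sum>y\<in>#W. f y u) \<and>
    (LINT u|M. (\<Sum>y\<in>#W. f y u)) = (\<Sum>y\<in>#W. (LINT u|M. f y u))"
  using assms by (induction W) auto

context haar_orthogonal
begin

text \<open>Schwinger--Dyson equation, obtained by summing over \<open>s \<noteq> r\<close> the invariance
  under infinitesimal rotations of the rows \<open>r\<close> and \<open>s\<close> of the monomial \<open>u\<^sub>s\<^sub>c G\<close>.\<close>

lemma moment_loop_equation:
  assumes rc: "r < n" "c < n" and G: "set_mset G \<subseteq> {..<n} \<times> {..<n}"
  shows "(real n - 1) * moment M (add_mset (r, c) G) =
    real (count G (r, c)) * moment M (G - {#(r, c)#})
    - (\<Sum>y\<in>#G. moment M (add_mset (r, snd y) (add_mset (fst y, c) (G - {#y#}))))"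
proof -
  let ?f = "\<lambda>y u. (if y = (r, c) then monomial_at u (G - {#y#}) else 0)
        - monomial_at u (add_mset (r, snd y) (add_mset (fst y, c) (G - {#y#})))"
  have sub: "set_mset (G - {#y#}) \<subseteq> {..<n} \<times> {..<n}" for y
    using G by (meson in_diffD subset_iff)
  have sub2: "set_mset (add_mset (r, snd y) (add_mset (fst y, c) (G - {#y#}))) \<subseteq> {..<n} \<times> {..<n}"
    if "y \<in># G" for y
    using G that rc sub[of y] by (auto simp: mem_Times_iff)
  have int: "integrable M (?f y)" if "y \<in># G" for y
    using integrable_monomial_at[OF sub[of y]] integrable_monomial_at[OF sub2[OF that]]
    by (cases "y = (r, c)") (simp_all del: monomial_at_add)
  have sub3: "set_mset (add_mset (s, c) G) \<subseteq> {..<n} \<times> {..<n}" if "s < n" for s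
    using that rc G by auto
  have "0 = (\<Sum>s\<in>{..<n} - {r}. (LINT u|M. monomial_derivative r s u (add_mset (s, c) G)))"
    using rc sub3 integral_monomial_derivative by (intro sum.neutral[symmetric]) (auto simp del: monomial_derivative_add)
  also have "\<dots> = (LINT u|M. (\<Sum>s\<in>{..<n} - {r}. monomial_derivative r s u (add_mset (s, c) G)))"
    using rc sub3 by (intro Bochner_Integration.integral_sum[symmetric] integrable_monomial_derivative)
      (auto simp del: monomial_derivative_add)
  also have "\<dots> = (LINT u|M. (\<Sum>y\<in>#G. ?f y u) - (real n - 1) * monomial_at u (add_mset (r, c) G))"
    using sum_monomial_derivative[OF _ rc G]
    by (intro Bochner_Integration.integral_cong refl) (simp only: space_haar)
  also have "\<dots> = (LINT u|M. (\<Sum>y\<in>#G. ?f y u)) - (real n - 1) * moment M (add_mset (r, c) G)"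
    unfolding moment_def using integral_sum_mset[of G M ?f] int
      integrable_monomial_at[OF sub3[OF rc(1)]]
    by (subst Bochner_Integration.integral_diff) (auto simp del: monomial_at_add)
  also have "(LINT u|M. (\<Sum>y\<in>#G. ?f y u)) = (\<Sum>y\<in>#G. (LINT u|M. ?f y u))"
    using integral_sum_mset[of G M ?f] int by blast
  also have "\<dots> = (\<Sum>y\<in>#G. (if y = (r, c) then moment M (G - {#(r, c)#}) else 0)
        - moment M (add_mset (r, snd y) (add_mset (fst y, c) (G - {#y#}))))"
  proof (intro arg_cong[of _ _ sum_mset] image_mset_cong)
    fix y assume y: "y \<in># G"
    show "(LINT u|M. ?f y u) = (if y = (r, c) then moment M (G - {#(r, c)#}) else 0)
        - moment M (add_mset (r, snd y) (add_mset (fst y, c) (G - {#y#})))"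
      using integrable_monomial_at[OF sub[of y]] integrable_monomial_at[OF sub2[OF y]]
      by (cases "y = (r, c)") (simp_all add: moment_def del: monomial_at_add)
  qed
  also have "\<dots> = (\<Sum>y\<in>#G. if y = (r, c) then moment M (G - {#(r, c)#}) else 0)
      - (\<Sum>y\<in>#G. moment M (add_mset (r, snd y) (add_mset (fst y, c) (G - {#y#}))))"
    (is "sum_mset (image_mset (\<lambda>y. ?a y - ?b y) G) = _")
  proof -
    have "(\<Sum>y\<in>#V. a y - b y) = (\<Sum>y\<in>#V. a y) - (\<Sum>y\<in>#V. b y)"
      for V :: "(nat \<times> nat) multiset" and a b :: "nat \<times> nat \<Rightarrow> real"
      by (induction V) auto
    then show ?thesis .
  qed
  \<comment> \<open>The same moment is collected once per occurrence of \<open>(r, c)\<close> in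
    \<open>G\<close>, which yields the factor \<open>count G (r, c)\<close>.\<close>
  finally show ?thesis by (simp add: sum_mset_delta algebra_simps)
qed

lemma abs_moment_le_1:
  assumes "set_mset W \<subseteq> {..<n} \<times> {..<n}"
  shows "\<bar>moment M W\<bar> \<le> 1"
proof -
  have "\<bar>moment M W\<bar> \<le> (LINT u|M. 1)"
    unfolding moment_def using assms integrable_monomial_at[OF assms]
    by (intro order_trans[OF integral_abs_bound] integral_mono)
       (auto simp: space_haar abs_monomial_at_le)
  then show ?thesis by (simp add: prob_space)
qed

end

section \<open>Uniform bounds on all moments of a given length\<close>

lemma abs_sum_mset_le:
  fixes f :: "'a \<Rightarrow> real" and B :: real
  assumes "\<And>y. y \<in># W \<Longrightarrow> \<bar>f y\<bar> \<le> B"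
  shows "\<bar>\<Sum>y\<in>#W. f y\<bar> \<le> real (size W) * B"
  using assms
proof (induction W)
  case (add x W)
  then have "\<bar>f x\<bar> \<le> B" "\<bar>\<Sum>y\<in>#W. f y\<bar> \<le> real (size W) * B" by auto
  then show ?case by (simp add: algebra_simps)
qed simp

definition words :: "nat \<Rightarrow> nat \<Rightarrow> (nat \<times> nat) multiset set" where
  "words n l = {W. set_mset W \<subseteq> {..<n} \<times> {..<n} \<and> size W = l}"

lemma words_remove: "W \<in> words n (Suc l) \<Longrightarrow> x \<in># W \<Longrightarrow> W - {#x#} \<in> words n l"
  by (auto simp: words_def size_Diff_singleton dest: in_diffD)

lemma words_exchange:
  "add_mset (r, c) G \<in> words n l \<Longrightarrow> y \<in># G \<Longrightarrow>
    add_mset (r, snd y) (add_mset (fst y, c) (G - {#y#})) \<in> words n l"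
  by (auto simp: words_def mem_Times_iff size_Suc_Diff1 dest: in_diffD)

context haar_orthogonal
begin

text \<open>The loop equation has \<open>2 * k + 1\<close> exchange terms; replacing the factor
  \<open>n - 1\<close> by \<open>n\<close> costs one more moment of the same length, hence
  \<open>2 * Suc k\<close>.\<close>

lemma abs_moment_step:
  assumes W: "add_mset (r, c) G \<in> words n (2 * Suc k)"
    and B: "\<And>V. V \<in> words n (2 * Suc k) \<Longrightarrow> \<bar>moment M V\<bar> \<le> B"
  shows "\<bar>real n * moment M (add_mset (r, c) G)
      - real (count G (r, c)) * moment M (G - {#(r, c)#})\<bar> \<le> real (2 * Suc k) * B"
proof -
  have rc: "r < n" "c < n" and G: "set_mset G \<subseteq> {..<n} \<times> {..<n}" and sz: "size G = 2 * k + 1"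
    using W by (auto simp: words_def)
  have "\<bar>\<Sum>y\<in>#G. moment M (add_mset (r, snd y) (add_mset (fst y, c) (G - {#y#})))\<bar> \<le> real (size G) * B"
    using B words_exchange[OF W] by (intro abs_sum_mset_le) auto
  moreover have "\<bar>moment M (add_mset (r, c) G)\<bar> \<le> B" using B W by auto
  ultimately show ?thesis
    using moment_loop_equation[OF rc G] by (simp add: sz algebra_simps)
qed

end

text \<open>The supremum \<open>S\<close> over words of length \<open>2 * Suc k\<close> satisfies
  \<open>n * S \<le> K * C / n ^ k + 2 * Suc k * S\<close>. For \<open>n \<ge> 4 * Suc k\<close> the
  last term is at most half of the left side and can be absorbed. The constant is uniform in
  \<open>n\<close>, \<open>M\<close> and \<open>W\<close>.\<close>

lemma moment_bound:
  "\<exists>C\<ge>0. \<forall>n M W. n \<ge> 1 \<longrightarrow> n \<ge> 4 * k \<longrightarrow> normalized_haar n M \<longrightarrow> W \<in> words n (2 * k) \<longrightarrow>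
    \<bar>moment M W\<bar> \<le> C / real n ^ k"
proof (induction k)
  case 0
  have "\<bar>moment M W\<bar> \<le> 1" if "normalized_haar n M" "W \<in> words n 0" for n M W
    using haar_orthogonal.abs_moment_le_1[OF haar_orthogonal.intro[OF that(1)]] that(2)
    by (auto simp: words_def)
  then show ?case by (intro exI[of _ 1]) auto
next
  case (Suc k)
  then obtain C where C: "C \<ge> 0" "\<And>n M W. n \<ge> 1 \<Longrightarrow> n \<ge> 4 * k \<Longrightarrow> normalized_haar n M \<Longrightarrow>
    W \<in> words n (2 * k) \<Longrightarrow> \<bar>moment M W\<bar> \<le> C / real n ^ k"
    by blast
  \<comment> \<open>The length of \<open>G\<close>, and so a bound for any multiplicity in
    it.\<close>
  define K where "K = 2 * real k + 1"
  show ?case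
  proof (intro exI[of _ "2 * K * C"] conjI allI impI)
    fix n M W
    assume n: "n \<ge> 1" "n \<ge> 4 * Suc k" and M: "normalized_haar n M" and W: "W \<in> words n (2 * Suc k)"
    interpret haar_orthogonal n M by unfold_locales (rule M)
    define S where "S = (SUP V\<in>words n (2 * Suc k). \<bar>moment M V\<bar>)"
    \<comment> \<open>The a priori bound 1 guarantees that the real supremum is genuine.\<close>
    have bdd: "bdd_above ((\<lambda>V. \<bar>moment M V\<bar>) ` words n (2 * Suc k))"
      using abs_moment_le_1 by (intro bdd_aboveI2[where M = 1]) (auto simp: words_def)
    have S: "\<bar>moment M V\<bar> \<le> S" if "V \<in> words n (2 * Suc k)" for V
      unfolding S_def by (rule cSUP_upper[OF that bdd])
    have S0: "S \<ge> 0" using S[OF W] by linarith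
    have le: "real n * \<bar>moment M V\<bar> \<le> K * C / real n ^ k + real (2 * Suc k) * S"
      if V: "V \<in> words n (2 * Suc k)" for V
    proof -
      obtain x G where "V = add_mset x G"
        using V by (cases V) (auto simp: words_def)
      then obtain r c where VG: "V = add_mset (r, c) G" by (cases x) auto
      have G: "G \<in> words n (Suc (2 * k))" using V VG by (auto simp: words_def)
      have "real (count G (r, c)) * \<bar>moment M (G - {#(r, c)#})\<bar> \<le> K * (C / real n ^ k)"
      proof (cases "(r, c) \<in># G")
        case True
        have "real (count G (r, c)) \<le> K"
          using count_le_size[of G "(r, c)"] G by (simp add: K_def words_def)
        then show ?thesis
          using C(2)[OF n(1) _ M words_remove[OF G True]] n K_def by (intro mult_mono) auto
      next
        case False
        then show ?thesis using C(1) by (simp add: K_def not_in_iff)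
      qed
      then have "\<bar>real (count G (r, c)) * moment M (G - {#(r, c)#})\<bar> \<le> K * C / real n ^ k"
        by (simp add: abs_mult)
      moreover have "\<bar>real n * moment M V - real (count G (r, c)) * moment M (G - {#(r, c)#})\<bar>
          \<le> real (2 * Suc k) * S"
        unfolding VG using V VG S by (intro abs_moment_step) auto
      ultimately have "\<bar>real n * moment M V\<bar> \<le> K * C / real n ^ k + real (2 * Suc k) * S"
        by linarith
      then show ?thesis by (simp only: abs_mult abs_of_nat)
    qed
    define R where "R = (K * C / real n ^ k + real (2 * Suc k) * S) / real n"
    have "\<bar>moment M V\<bar> \<le> R" if "V \<in> words n (2 * Suc k)" for V
      unfolding R_def using le[OF that] n by (subst pos_le_divide_eq) (simp, simp only: mult.commute)
    then have "S \<le> R"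
      unfolding S_def using W by (intro cSUP_least) auto
    then have "real n * S \<le> K * C / real n ^ k + real (2 * Suc k) * S"
      unfolding R_def using n by (subst (asm) pos_le_divide_eq) (simp, simp only: mult.commute)
    \<comment> \<open>The absorption step; it accounts for the factor 2 in the witness
      \<open>2 * K * C\<close>.\<close>
    moreover have "(real n / 2) * S \<ge> real (2 * Suc k) * S"
      using n S0 by (intro mult_right_mono) auto
    ultimately have "real n * S \<le> 2 * (K * C / real n ^ k)" by simp
    then have "S \<le> 2 * K * C / real n ^ Suc k"
      using n by (simp add: field_simps)
    then show "\<bar>moment M W\<bar> \<le> 2 * K * C / real n ^ Suc k"
      using S[OF W] by linarith
  qed (use C K_def in auto)
qed

section \<open>Leading coefficients and Gaussian moments\<close>

text \<open>The \<open>m\<close>-th moment of a standard normal variable: in the shifted convention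
  \<open>dfact m\<close> is the product (m - 1)(m - 3)...1 for even \<open>m\<close>.\<close>

definition gaussian_moment :: "nat \<Rightarrow> real" where
  "gaussian_moment m = (if even m then real (dfact m) else 0)"

lemma gaussian_moment_simps [simp]:
  "gaussian_moment 0 = 1" "gaussian_moment (Suc 0) = 0"
  "gaussian_moment (Suc (Suc m)) = real (Suc m) * gaussian_moment m"
  by (auto simp: gaussian_moment_def algebra_simps)

text \<open>Induction on \<open>k\<close>, stripping one factor \<open>x\<close>: by
  \<open>abs_moment_step\<close> and \<open>moment_bound\<close> the exchange terms are of lower
  order, so the leading coefficient obeys the Gaussian recursion in the multiplicity of
  \<open>x\<close>. The set \<open>A\<close> may exceed the support of \<open>W\<close>, as
  \<open>gaussian_moment 0 = 1\<close>.\<close>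

lemma moment_asymptotics:
  assumes "finite A" "set_mset W \<subseteq> A" "size W = 2 * k"
  shows "\<exists>C N. \<forall>n\<ge>N. \<forall>M. normalized_haar n M \<longrightarrow> A \<subseteq> {..<n} \<times> {..<n} \<longrightarrow>
    \<bar>moment M W - (\<Prod>x\<in>A. gaussian_moment (count W x)) / real n ^ k\<bar> \<le> C / real n ^ (k + 1)"
  using assms(2,3)
proof (induction k arbitrary: W)
  case 0
  have "moment M {#} = 1" if "normalized_haar n M" for n M
  proof -
    interpret haar_orthogonal n M by unfold_locales (rule that)
    show ?thesis by (simp add: moment_def prob_space)
  qed
  with 0 show ?case by (intro exI[of _ 0]) auto
next
  case (Suc k)
  let ?L = "\<lambda>V. \<Prod>x\<in>A. gaussian_moment (count V x)"
  obtain x G where W: "W = add_mset x G" using Suc.prems by (cases W) auto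
  obtain r c where x: "x = (r, c)" by (cases x)
  have sz: "size G = Suc (2 * k)" and xA: "x \<in> A" using Suc.prems W by auto
  have split: "?L V = gaussian_moment (count V x) * (\<Prod>y\<in>A - {x}. gaussian_moment (count V y))" for V
    using assms(1) xA by (rule prod.remove)
  have "\<exists>C N. \<forall>n\<ge>N. \<forall>M. normalized_haar n M \<longrightarrow> A \<subseteq> {..<n} \<times> {..<n} \<longrightarrow>
    \<bar>real (count G x) * moment M (G - {#x#}) - ?L W / real n ^ k\<bar> \<le> C / real n ^ (k + 1)"
  proof (cases "x \<in># G")
    \<comment> \<open>Here \<open>count W x = count V x + 2\<close> and
      \<open>count G x = count V x + 1\<close>, which is exactly the factor in the Gaussian
      recursion.\<close>
    case True
    then obtain V where G: "G = add_mset x V" by (metis insert_DiffM)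
    have "size V = 2 * k" "set_mset V \<subseteq> A" using Suc.prems sz W G by auto
    from Suc.IH[OF this(2,1)] obtain C N where C: "\<And>n M. n \<ge> N \<Longrightarrow> normalized_haar n M \<Longrightarrow>
        A \<subseteq> {..<n} \<times> {..<n} \<Longrightarrow> \<bar>moment M V - ?L V / real n ^ k\<bar> \<le> C / real n ^ (k + 1)"
      by blast
    have "(\<Prod>y\<in>A - {x}. gaussian_moment (count W y)) = (\<Prod>y\<in>A - {x}. gaussian_moment (count V y))"
      using W G by (intro prod.cong) auto
    then have L: "?L W = real (count G x) * ?L V"
      unfolding split using W G by simp
    show ?thesis
    proof (intro exI[of _ "real (count G x) * C"] exI[of _ N] allI impI)
      fix n M assume "n \<ge> N" "normalized_haar n M" "A \<subseteq> {..<n} \<times> {..<n}"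
      from mult_left_mono[OF C[OF this], of "real (count G x)"]
      show "\<bar>real (count G x) * moment M (G - {#x#}) - ?L W / real n ^ k\<bar>
          \<le> real (count G x) * C / real n ^ (k + 1)"
        unfolding L using G by (simp add: abs_mult_pos' right_diff_distrib)
    qed
  next
    \<comment> \<open>Now \<open>x\<close> occurs exactly once in \<open>W\<close>, and
      \<open>gaussian_moment 1 = 0\<close> matches the vanishing multiplicity in
      \<open>G\<close>.\<close>
    case False
    then have "?L W = 0" unfolding split using W by (simp add: not_in_iff)
    with False show ?thesis by (intro exI[of _ 0]) (simp add: not_in_iff)
  qed
  then obtain C N where C: "\<And>n M. n \<ge> N \<Longrightarrow> normalized_haar n M \<Longrightarrow> A \<subseteq> {..<n} \<times> {..<n} \<Longrightarrow>
    \<bar>real (count G x) * moment M (G - {#x#}) - ?L W / real n ^ k\<bar> \<le> C / real n ^ (k + 1)"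
    by blast
  obtain B where B: "\<And>n M V. n \<ge> 1 \<Longrightarrow> n \<ge> 4 * Suc k \<Longrightarrow> normalized_haar n M \<Longrightarrow>
      V \<in> words n (2 * Suc k) \<Longrightarrow> \<bar>moment M V\<bar> \<le> B / real n ^ Suc k"
    using moment_bound[of "Suc k"] by blast
  show ?case
  \<comment> \<open>\<open>C\<close> is the error inherited from the shorter word, the other summand
    that of the exchange terms; \<open>4 * Suc k\<close> is the threshold of
    \<open>moment_bound\<close>.\<close>
  proof (intro exI[of _ "C + real (2 * Suc k) * B"] exI[of _ "N + 4 * Suc k"] allI impI)
    fix n M assume n: "n \<ge> N + 4 * Suc k" and M: "normalized_haar n M" and A: "A \<subseteq> {..<n} \<times> {..<n}"
    interpret haar_orthogonal n M by unfold_locales (rule M)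
    have "add_mset (r, c) G \<in> words n (2 * Suc k)"
      using Suc.prems A W x by (auto simp: words_def)
    then have "\<bar>real n * moment M W - real (count G x) * moment M (G - {#x#})\<bar>
        \<le> real (2 * Suc k) * (B / real n ^ Suc k)"
      unfolding W x using B M n by (intro abs_moment_step) auto
    then have "\<bar>real n * moment M W - ?L W / real n ^ k\<bar> \<le> (C + real (2 * Suc k) * B) / real n ^ (k + 1)"
      using C[OF _ M A] n by (simp add: add_divide_distrib)
    moreover have "real n * moment M W - ?L W / real n ^ k = real n * (moment M W - ?L W / real n ^ Suc k)"
      using n by (simp add: field_simps)
    ultimately have "real n * \<bar>moment M W - ?L W / real n ^ Suc k\<bar>
        \<le> (C + real (2 * Suc k) * B) / real n ^ (k + 1)"
      by (simp add: abs_mult)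
    then have "\<bar>moment M W - ?L W / real n ^ Suc k\<bar> \<le> (C + real (2 * Suc k) * B) / real n ^ (k + 1) / real n"
      using n by (subst pos_le_divide_eq) (simp, simp only: mult.commute)
    then show "\<bar>moment M W - ?L W / real n ^ Suc k\<bar> \<le> (C + real (2 * Suc k) * B) / real n ^ (Suc k + 1)"
      by (simp add: mult.commute)
  qed
qed

section \<open>From exponent matrices to words, and the asymptotics of the integral\<close>

definition exponent_multiset :: "nat mat \<Rightarrow> (nat \<times> nat) multiset" where
  "exponent_multiset a =
     (\<Sum>x\<in>{..<dim_row a} \<times> {..<dim_col a}. replicate_mset (a $$ x) x)"

lemma count_size_sum_replicate:
  assumes "finite A"
  shows "count (\<Sum>x\<in>A. replicate_mset (f x) x) y = (if y \<in> A then f y else 0)"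
    and "size (\<Sum>x\<in>A. replicate_mset (f x) x) = sum f A"
  using assms by (induction A) auto

lemma monomial_at_sum_replicate:
  "monomial_at u (\<Sum>x\<in>A. replicate_mset (f x) x) = (\<Prod>x\<in>A. u $$ x ^ f x)"
  by (induction A rule: infinite_finite_induct) (auto simp: monomial_at_def)

lemma orthogonal_integral_eq_moment:
  "orthogonal_integral M a = moment M (exponent_multiset a)"
  unfolding orthogonal_integral_def moment_def exponent_multiset_def
  by (simp add: monomial_at_sum_replicate prod.cartesian_product)

theorem theorem3p2:
  fixes p q k :: nat and a :: "nat mat" and \<mu> :: "nat \<Rightarrow> real mat measure"
  assumes "p \<ge> 1" and "q \<ge> 1"
    and "a \<in> carrier_mat p q"
    and "even (\<Sum>i<p. \<Sum>j<q. a $$ (i, j))"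
    and "k = (\<Sum>i<p. \<Sum>j<q. a $$ (i, j)) div 2"
    and "\<And>n. n \<ge> max p q \<Longrightarrow> normalized_haar n (\<mu> n)"
  shows
    "((\<forall>i<p. \<forall>j<q. even (a $$ (i, j))) \<longrightarrow>
        (\<exists>E :: nat \<Rightarrow> real. E \<in> O(\<lambda>n. 1 / real n) \<and>
           (\<forall>n \<ge> max p q. orthogonal_integral (\<mu> n) a =
              1 / real n ^ k * ((\<Prod>i<p. \<Prod>j<q. real (dfact (a $$ (i, j)))) + E n)))) \<and>
     (\<not> (\<forall>i<p. \<forall>j<q. even (a $$ (i, j))) \<longrightarrow>
        (\<lambda>n. orthogonal_integral (\<mu> n) a) \<in> O(\<lambda>n. 1 / real n ^ (k + 1)))"
proof -
  let ?A = "{..<p} \<times> {..<q}" and ?I = "\<lambda>n. orthogonal_integral (\<mu> n) a"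
  \<comment> \<open>One constant serves both cases: it is the double factorial product if all
    exponents are even, and 0 otherwise.\<close>
  define L where "L = (\<Prod>i<p. \<Prod>j<q. gaussian_moment (a $$ (i, j)))"
  have dim: "dim_row a = p" "dim_col a = q" using assms(3) by auto
  have count: "count (exponent_multiset a) y = (if y \<in> ?A then a $$ y else 0)" for y
    unfolding exponent_multiset_def dim by (intro count_size_sum_replicate) auto
  have "set_mset (exponent_multiset a) \<subseteq> ?A"
    using count by (auto simp: set_mset_def split: if_splits)
  moreover have "size (exponent_multiset a) = 2 * k"
    using assms(4,5) unfolding exponent_multiset_def dim
    by (subst count_size_sum_replicate) (auto simp: sum.cartesian_product)
  moreover have "(\<Prod>x\<in>?A. gaussian_moment (count (exponent_multiset a) x)) = L"
    unfolding L_def prod.cartesian_product by (intro prod.cong) (auto simp: count)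
  ultimately obtain C N where CN: "\<And>n M. n \<ge> N \<Longrightarrow> normalized_haar n M \<Longrightarrow>
      ?A \<subseteq> {..<n} \<times> {..<n} \<Longrightarrow>
      \<bar>moment M (exponent_multiset a) - L / real n ^ k\<bar> \<le> C / real n ^ (k + 1)"
    using moment_asymptotics[of ?A "exponent_multiset a" k]
    by (metis finite_lessThan finite_cartesian_product)
  have bound: "\<bar>?I n - L / real n ^ k\<bar> \<le> C / real n ^ (k + 1)" if "n \<ge> max N (max p q)" for n
    unfolding orthogonal_integral_eq_moment using that by (intro CN assms(6)) auto
  show ?thesis
  proof (intro conjI impI)
    assume even: "\<forall>i<p. \<forall>j<q. even (a $$ (i, j))"
    then have L: "L = (\<Prod>i<p. \<Prod>j<q. real (dfact (a $$ (i, j))))"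
      unfolding L_def by (intro prod.cong) (auto simp: gaussian_moment_def)
    \<comment> \<open>Solving for the error makes the identity exact for every
      \<open>n \<ge> max p q\<close>, where \<open>n\<close> is positive; only the estimate of
      \<open>E\<close> needs large \<open>n\<close>.\<close>
    define E where "E n = real n ^ k * ?I n - L" for n
    have "\<bar>E n\<bar> \<le> C * \<bar>1 / real n\<bar>" if "n \<ge> max N (max p q)" for n
    proof -
      have n: "n > 0" using that assms(1) by auto
      then have "E n = real n ^ k * (?I n - L / real n ^ k)"
        unfolding E_def by (simp add: right_diff_distrib)
      also have "\<bar>\<dots>\<bar> \<le> real n ^ k * (C / real n ^ (k + 1))"
        unfolding abs_mult using bound[OF that] by (intro mult_mono) auto
      finally show ?thesis using n by simp
    qed
    then have "E \<in> O(\<lambda>n. 1 / real n)"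
      by (intro bigoI[of _ C] eventually_sequentiallyI[of "max N (max p q)"]) auto
    moreover have "?I n = 1 / real n ^ k * (L + E n)" if "n \<ge> max p q" for n
      using that assms(1) by (simp add: E_def)
    ultimately show "\<exists>E :: nat \<Rightarrow> real. E \<in> O(\<lambda>n. 1 / real n) \<and>
        (\<forall>n \<ge> max p q. ?I n = 1 / real n ^ k * ((\<Prod>i<p. \<Prod>j<q. real (dfact (a $$ (i, j)))) + E n))"
      unfolding L by blast
  next
    assume "\<not> (\<forall>i<p. \<forall>j<q. even (a $$ (i, j)))"
    then have "L = 0"
      unfolding L_def prod.cartesian_product by (intro prod_zero) (auto simp: gaussian_moment_def)
    with bound show "?I \<in> O(\<lambda>n. 1 / real n ^ (k + 1))"
      by (intro bigoI[of _ C] eventually_sequentiallyI[of "max N (max p q)"]) auto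
  qed
qed

end
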